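(* Let $S_1\ge \|f'\|_{C[-1,1]}=2$ and $\|\phi_{\mathrm{init}}\|_\infty\le 1$. Let $\{\phi^n\}_{n=0}^N\subset\mathbb V_h$ be a solution of the DsBE scheme, i.e. $\phi^0=\phi_{\mathrm{init}}$ on $\Omega_h$ and, for $0\le n\le N-1$, $$\frac{\phi^{n+1}-\phi^n}{\tau_{n+1}}=-\mathcal M(\phi^n)\,\mu^{n+1},\qquad \mu^{n+1}=-\varepsilon^2\Delta_h\phi^{n+1}-f(\phi^n)+S_1(\phi^{n+1}-\phi^n),$$ with products and compositions taken pointwise on the grid. Then the scheme is unconditionally energy dissipative: with no restriction on the sizes of $\tau_1,\dots,\tau_N>0$ and $h>0$, $$E_h[\phi^{n+1}]-E_h[\phi^n]\le -\tau_{n+1}\,\langle \mathcal M(\phi^n)\mu^{n+1},\mu^{n+1}\rangle\qquad\text{for all }0\le n\le N-1.$$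
   Context: The scheme discretizes the Allen--Cahn equation $\phi_t=-\mathcal M(\phi)\mu$, $\mu=-\varepsilon^2\Delta\phi-f(\phi)$ on $\Omega=[0,L]^d$, $d\in\{1,2,3\}$, with periodic boundary conditions and initial datum $\phi_{\mathrm{init}}$. Here $\varepsilon>0$, $F(s)=\frac14(1-s^2)^2$, $f(s)=-F'(s)=s-s^3$. The mobility $\mathcal M$ is a nonnegative, possibly degenerate (it may vanish) real function; only its values on $[-1,1]$ matter (e.g. $\mathcal M(s)=(1-s^2)^m$, $m>0$). Spatial grid: $M$ is a positive integer, $h=L/M$, $\Omega_h=\{\mathbf x_{\mathbf i}=h\mathbf i:\mathbf i\in\{1,\dots,M\}^d\}$. $\mathbb V_h$ is the set of real-valued grid functions $v=\{v_{\mathbf i}\}$ that are $M$-periodic in each index. $\langle v,w\rangle=h^d\sum_{\mathbf x_{\mathbf i}\in\Omega_h}v_{\mathbf i}w_{\mathbf i}$, $\|v\|_\infty=\max_{\mathbf x_{\mathbf i}\in\Omega_h}|v_{\mathbf i}|$. $\Delta_h$ is the standard second-order central difference Laplacian with periodic indices: $(\Delta_h v)_{\mathbf i}=h^{-2}\sum_{k=1}^d (v_{\mathbf i+\mathbf e_k}-2v_{\mathbf i}+v_{\mathbf i-\mathbf e_k})$, $\mathbf e_k$ being the $k$-th coordinate vector. The discrete energy is $$E_h[v]=-\frac{\varepsilon^2}{2}\langle\Delta_h v,v\rangle+\langle F(v),1\rangle .$$ Time grid: $0=t_0<t_1<\dots<t_N=T$, $\tau_k=t_k-t_{k-1}$ (variable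 step sizes). *)

theory Defs
  imports "HOL-Analysis.Analysis"
begin

text \<open>
  The dimension \<open>d\<close> is \<open>CARD('d)\<close> for a finite index type \<open>'d\<close>.  A grid function is a real
  function of all integer multi-indices; the grid itself is the period cell \<open>{1..M}\<^sup>d\<close>.
\<close>

type_synonym 'd gridfun = "int ^ 'd \<Rightarrow> real"

definition grid_idx :: "nat \<Rightarrow> (int ^ 'd::finite) set" where
  "grid_idx M = {i. \<forall>k. i $ k \<in> {1..int M}}"

definition grid_point :: "real \<Rightarrow> int ^ 'd::finite \<Rightarrow> real ^ 'd" where
  "grid_point h i = (\<chi> k. h * of_int (i $ k))"

definition grid_space :: "nat \<Rightarrow> ('d::finite) gridfun set" where
  "grid_space M = {v. \<forall>i k. v (i + axis k (int M)) = v i}"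

definition grid_inner :: "real \<Rightarrow> nat \<Rightarrow> ('d::finite) gridfun \<Rightarrow> 'd gridfun \<Rightarrow> real" where
  "grid_inner h M v w = h ^ CARD('d) * (\<Sum>i\<in>grid_idx M. v i * w i)"

definition grid_norm_inf :: "nat \<Rightarrow> ('d::finite) gridfun \<Rightarrow> real" where
  "grid_norm_inf M v = Max ((\<lambda>i. \<bar>v i\<bar>) ` grid_idx M)"

definition grid_laplacian :: "real \<Rightarrow> ('d::finite) gridfun \<Rightarrow> 'd gridfun" where
  "grid_laplacian h v =
     (\<lambda>i. (1 / h\<^sup>2) * (\<Sum>k\<in>UNIV. v (i + axis k 1) - 2 * v i + v (i - axis k 1)))"

definition pot_F :: "real \<Rightarrow> real" where
  "pot_F s = (1 - s\<^sup>2)\<^sup>2 / 4"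

definition pot_f :: "real \<Rightarrow> real" where
  "pot_f s = s - s ^ 3"

definition grid_energy :: "real \<Rightarrow> real \<Rightarrow> nat \<Rightarrow> ('d::finite) gridfun \<Rightarrow> real" where
  "grid_energy \<epsilon> h M v =
     - (\<epsilon>\<^sup>2 / 2) * grid_inner h M (grid_laplacian h v) v
     + grid_inner h M (\<lambda>i. pot_F (v i)) (\<lambda>i. 1)"

definition DsBE_solution ::
  "real \<Rightarrow> (real \<Rightarrow> real) \<Rightarrow> real \<Rightarrow> real \<Rightarrow> nat \<Rightarrow> nat \<Rightarrow> (nat \<Rightarrow> real) \<Rightarrow>
   (real ^ 'd \<Rightarrow> real) \<Rightarrow> (nat \<Rightarrow> ('d::finite) gridfun) \<Rightarrow> (nat \<Rightarrow> 'd gridfun) \<Rightarrow> bool" where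
  "DsBE_solution \<epsilon> mob S1 h M N \<tau> \<phi>init \<phi> \<mu> \<longleftrightarrow>
     (\<forall>n\<le>N. \<phi> n \<in> grid_space M) \<and>
     (\<forall>i\<in>grid_idx M. \<phi> 0 i = \<phi>init (grid_point h i)) \<and>
     (\<forall>n<N. \<forall>i.
        (\<phi> (n + 1) i - \<phi> n i) / \<tau> (n + 1) = - mob (\<phi> n i) * \<mu> (n + 1) i \<and>
        \<mu> (n + 1) i = - \<epsilon>\<^sup>2 * grid_laplacian h (\<phi> (n + 1)) i - pot_f (\<phi> n i)
                      + S1 * (\<phi> (n + 1) i - \<phi> n i))"

lemma pot_F_has_derivative: "(pot_F has_real_derivative - pot_f s) (at s)"
  unfolding pot_F_def [abs_def] pot_f_def
  by (rule derivative_eq_intros refl | simp)+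
     (simp add: algebra_simps power2_eq_square power3_eq_cube)

lemma deriv_pot_f: "deriv pot_f s = 1 - 3 * s\<^sup>2"
  by (rule DERIV_imp_deriv, unfold pot_f_def [abs_def])
     (rule derivative_eq_intros refl | simp)+

lemma SUP_deriv_pot_f: "(SUP s\<in>{-1..1}. \<bar>deriv pot_f s\<bar>) = 2"
proof (rule cSup_eq_maximum)
  show "2 \<in> (\<lambda>s. \<bar>deriv pot_f s\<bar>) ` {-1..1}"
    by (rule image_eqI [of _ _ 1]) (simp_all add: deriv_pot_f)
next
  fix y assume "y \<in> (\<lambda>s. \<bar>deriv pot_f s\<bar>) ` {-1..1}"
  then obtain s :: real where s: "-1 \<le> s" "s \<le> 1" "y = \<bar>1 - 3 * s\<^sup>2\<bar>"
    by (auto simp: deriv_pot_f)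
  then have "s\<^sup>2 \<le> 1" by (simp add: abs_le_iff abs_square_le_1)
  with s(3) show "y \<le> 2" using zero_le_power2 [of s] by linarith
qed

lemma finite_grid_idx: "finite (grid_idx M :: (int ^ 'd::finite) set)"
proof (rule finite_surj)
  show "finite (PiE (UNIV :: 'd set) (\<lambda>_. {1..int M}))"
    by (intro finite_PiE) auto
  show "grid_idx M \<subseteq> vec_lambda ` PiE (UNIV :: 'd set) (\<lambda>_. {1..int M})"
  proof
    fix i :: "int ^ 'd" assume "i \<in> grid_idx M"
    then show "i \<in> vec_lambda ` PiE (UNIV :: 'd set) (\<lambda>_. {1..int M})"
      by (intro image_eqI [of _ _ "vec_nth i"]) (auto simp: grid_idx_def)
  qed
qed

lemma grid_idx_nonempty: "M > 0 \<Longrightarrow> (grid_idx M :: (int ^ 'd::finite) set) \<noteq> {}"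
  by (auto simp: grid_idx_def intro!: exI [of _ "\<chi> k. 1"])

end

theory Submission
  imports Defs
begin

text \<open>
  Two facts are combined. First, the stabilisation yields a maximum principle: at a grid point where
  \<open>\<phi>\<^sup>n\<^sup>+\<^sup>1\<close> is maximal the discrete Laplacian is nonpositive, and \<open>f(a) \<le> 2(1 - a)\<close> on
  \<open>[-1,1]\<close> prevents the maximum from exceeding 1; the lower bound follows by the symmetry
  \<open>\<phi> \<mapsto> -\<phi>\<close>. Secondly, since \<open>F'' \<le> 2\<close> on \<open>[-1,1]\<close>, we have
  \<open>F(b) - F(a) \<le> -f(a)(b - a) + S\<^sub>1(b - a)\<^sup>2\<close>, while summation by parts makes the gradient
  energy convex; so the energy difference is at most \<open>\<langle>\<mu>, \<phi>\<^sup>n\<^sup>+\<^sup>1 - \<phi>\<^sup>n\<rangle>\<close>, into which the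
  scheme is substituted.
\<close>

section \<open>Periodicity and the period cell\<close>

text \<open>The representative of an index modulo \<open>M\<close> in the period cell; the shift by
  one is there because the cell is \<open>{1..M}\<close>, not \<open>{0..M-1}\<close>.\<close>

definition grid_wrap :: "nat \<Rightarrow> int ^ 'd::finite \<Rightarrow> int ^ 'd" where
  "grid_wrap M j = (\<chi> k. (j $ k - 1) mod int M + 1)"

lemma grid_wrap_in: "M > 0 \<Longrightarrow> grid_wrap M j \<in> grid_idx M"
  by (auto simp: grid_wrap_def grid_idx_def add1_zle_eq)

lemma grid_wrap_id: "i \<in> grid_idx M \<Longrightarrow> grid_wrap M i = i"
proof -
  assume "i \<in> grid_idx M"
  then have "(i $ k - 1) mod int M = i $ k - 1" for k
    by (intro mod_pos_pos_trivial) (auto simp: grid_idx_def dest: spec[of _ k])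
  then show ?thesis by (simp add: grid_wrap_def vec_eq_iff)
qed

text \<open>This makes the wrapped shifts by \<open>e\<close> and \<open>-e\<close> mutually inverse
  on the cell.\<close>

lemma grid_wrap_add: "grid_wrap M (grid_wrap M i + e) = grid_wrap M (i + e)"
proof -
  have "((x - 1) mod m + 1 + y - 1) mod m = (x + y - 1) mod m" for x y m :: int
    by (metis (no_types, opaque_lifting) add.commute add_diff_cancel_left' add_diff_eq mod_add_left_eq)
  then show ?thesis
    by (simp add: grid_wrap_def vec_eq_iff)
qed

text \<open>Induction covers nonnegative multiples of the period; a negative multiple is undone by a
  positive one from the shifted index.\<close>

lemma grid_space_axis_mult:
  fixes v :: "('d::finite) gridfun"
  assumes "v \<in> grid_space M"
  shows "v (i + axis k (c * int M)) = v i"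
proof -
  have up: "v (j + axis k (int n * int M)) = v j" for j n
  proof (induction n)
    case 0
    have "axis k 0 = (0 :: int ^ 'd)" by (simp add: axis_def vec_eq_iff)
    then show ?case by (simp del: axis_eq_0_iff)
  next
    case (Suc n)
    have "j + axis k (int (Suc n) * int M) = (j + axis k (int n * int M)) + axis k (int M)"
      by (simp add: axis_def vec_eq_iff algebra_simps)
    moreover have "v (i + axis k (int M)) = v i" for i
      using assms by (simp add: grid_space_def)
    ultimately show ?case using Suc by (simp only:)
  qed
  show ?thesis
  proof (cases "c \<ge> 0")
    case True
    with up[of i "nat c"] show ?thesis by simp
  next
    case False
    have "(i + axis k (c * int M)) + axis k (int (nat (-c)) * int M) = i"
      using False by (simp add: axis_def vec_eq_iff)
    with up[of "i + axis k (c * int M)" "nat (-c)"] show ?thesis by (simp only:)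
  qed
qed

text \<open>An index and its wrapped form differ by \<open>c k\<close> periods in each direction
  \<open>k\<close>; these shifts are removed one coordinate at a time.\<close>

lemma grid_space_wrap:
  fixes v :: "('d::finite) gridfun"
  assumes "v \<in> grid_space M"
  shows "v (grid_wrap M j) = v j"
proof -
  define c where "c k = (j $ k - 1) div int M" for k
  have *: "v (i + (\<chi> k. if k \<in> K then c k * int M else 0)) = v i" if "finite K" for K i
    using that
  proof (induction K)
    case empty
    have "(\<chi> k. 0) = (0 :: int ^ 'd)" by (simp add: vec_eq_iff)
    then show ?case by simp
  next
    case (insert x K)
    have "i + (\<chi> k. if k \<in> insert x K then c k * int M else 0)
        = (i + (\<chi> k. if k \<in> K then c k * int M else 0)) + axis x (c x * int M)"
      using insert.hyps by (auto simp: axis_def vec_eq_iff)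
    with insert.IH show ?case by (simp only: grid_space_axis_mult[OF assms])
  qed
  have "grid_wrap M j + (\<chi> k. if k \<in> UNIV then c k * int M else 0) = j"
    by (simp add: grid_wrap_def c_def vec_eq_iff)
  with *[of UNIV "grid_wrap M j"] show ?thesis by simp
qed

section \<open>Summation by parts and the gradient energy\<close>

text \<open>The wrapped shift by \<open>e\<close> permutes the cell, and a periodic function does
  not see the wrapping.\<close>

lemma grid_sum_shift:
  fixes v :: "('d::finite) gridfun"
  assumes "M > 0" "v \<in> grid_space M"
  shows "(\<Sum>i\<in>grid_idx M. v (i + e)) = (\<Sum>i\<in>grid_idx M. v i)"
  by (rule sum.reindex_bij_witness[where i = "\<lambda>i. grid_wrap M (i + (- e))" and
        j = "\<lambda>i. grid_wrap M (i + e)"])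
     (use assms in \<open>simp_all only: grid_wrap_add grid_wrap_in grid_space_wrap
        add.assoc add.left_inverse add.right_inverse add.right_neutral grid_wrap_id\<close>)

text \<open>The second difference is a forward minus a backward difference. Shifting the sum with
  the backward one makes it a forward one, and periodicity leaves no boundary terms.\<close>

lemma grid_sum_by_parts:
  fixes u w :: "('d::finite) gridfun"
  assumes M: "M > 0" and u: "u \<in> grid_space M" and w: "w \<in> grid_space M"
  shows "(\<Sum>i\<in>grid_idx M. (u (i + e) - 2 * u i + u (i - e)) * w i)
       = - (\<Sum>i\<in>grid_idx M. (u (i + e) - u i) * (w (i + e) - w i))"
proof -
  have "u (i + axis k (int M) - e) = u (i - e)" for i k
  proof -
    have "i + axis k (int M) - e = (i - e) + axis k (int M)" by simp
    moreover have "u ((i - e) + axis k (int M)) = u (i - e)"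
      using u unfolding grid_space_def by blast
    ultimately show ?thesis by (simp only:)
  qed
  then have per: "(\<lambda>i. (u i - u (i - e)) * w i) \<in> grid_space M"
    using u w by (simp add: grid_space_def)
  have "(\<Sum>i\<in>grid_idx M. (u (i + e) - u i) * w (i + e))
      = (\<Sum>i\<in>grid_idx M. (u i - u (i - e)) * w i)"
    using grid_sum_shift[OF M per, of e] by simp
  then have "(\<Sum>i\<in>grid_idx M. (u (i + e) - u i) * (w (i + e) - w i))
      = (\<Sum>i\<in>grid_idx M. (u i - u (i - e)) * w i) - (\<Sum>i\<in>grid_idx M. (u (i + e) - u i) * w i)"
    by (simp add: right_diff_distrib sum_subtractf)
  moreover have "(\<Sum>i\<in>grid_idx M. (u (i + e) - 2 * u i + u (i - e)) * w i)
      = (\<Sum>i\<in>grid_idx M. (u (i + e) - u i) * w i) - (\<Sum>i\<in>grid_idx M. (u i - u (i - e)) * w i)"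
    unfolding sum_subtractf [symmetric] by (intro sum.cong refl) (simp add: algebra_simps)
  ultimately show ?thesis by simp
qed

lemma grid_inner_laplacian:
  fixes u w :: "('d::finite) gridfun"
  assumes "M > 0" "u \<in> grid_space M" "w \<in> grid_space M"
  shows "grid_inner h M (grid_laplacian h u) w
       = - (h ^ CARD('d) / h\<^sup>2) *
         (\<Sum>k\<in>UNIV. \<Sum>i\<in>grid_idx M. (u (i + axis k 1) - u i) * (w (i + axis k 1) - w i))"
proof -
  have "(\<Sum>i\<in>grid_idx M. grid_laplacian h u i * w i)
      = (1 / h\<^sup>2) * (\<Sum>i\<in>grid_idx M. \<Sum>k\<in>UNIV.
          (u (i + axis k 1) - 2 * u i + u (i - axis k 1)) * w i)"
    by (simp add: grid_laplacian_def sum_distrib_left sum_distrib_right mult.assoc)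
  also have "\<dots> = (1 / h\<^sup>2) * (\<Sum>k\<in>UNIV. \<Sum>i\<in>grid_idx M.
          (u (i + axis k 1) - 2 * u i + u (i - axis k 1)) * w i)"
    by (subst sum.swap) simp
  finally show ?thesis
    by (simp add: grid_inner_def grid_sum_by_parts[OF assms] sum_negf)
qed

text \<open>By summation by parts this is \<open>x * x - y * y \<le> 2 * (x * (x - y))\<close>, that
  is \<open>(x - y)\<^sup>2 \<ge> 0\<close>, for every directional difference. The negative sign of
  the Laplacian form reverses the inequality.\<close>

lemma gradient_energy_convex:
  fixes u w :: "('d::finite) gridfun"
  assumes M: "M > 0" and h: "h > 0" and u: "u \<in> grid_space M" and w: "w \<in> grid_space M"
  shows "grid_inner h M (grid_laplacian h u) u - grid_inner h M (grid_laplacian h w) w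
       \<ge> 2 * grid_inner h M (grid_laplacian h u) (\<lambda>i. u i - w i)"
proof -
  let ?D = "\<lambda>k v i. v (i + axis k 1) - v i :: real"
  have d: "(\<lambda>i. u i - w i) \<in> grid_space M"
    using u w by (simp add: grid_space_def)
  have "x * x - y * y \<le> 2 * (x * (x - y))" for x y :: real
    using zero_le_square[of "x - y"] by (simp add: algebra_simps)
  then have "(\<Sum>k\<in>UNIV. \<Sum>i\<in>grid_idx M. ?D k u i * ?D k u i - ?D k w i * ?D k w i)
      \<le> (\<Sum>k\<in>UNIV. \<Sum>i\<in>grid_idx M. 2 * (?D k u i * (?D k u i - ?D k w i)))"
    by (intro sum_mono)
  also have "\<dots> = 2 * (\<Sum>k\<in>UNIV. \<Sum>i\<in>grid_idx M. ?D k u i * ?D k (\<lambda>i. u i - w i) i)"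
    unfolding sum_distrib_left by (intro sum.cong refl arg_cong[where f = "\<lambda>x. 2 * x"]
        arg_cong[where f = "\<lambda>x. _ * x"]) linarith
  finally have *: "(\<Sum>k\<in>UNIV. \<Sum>i\<in>grid_idx M. ?D k u i * ?D k u i)
      - (\<Sum>k\<in>UNIV. \<Sum>i\<in>grid_idx M. ?D k w i * ?D k w i)
      \<le> 2 * (\<Sum>k\<in>UNIV. \<Sum>i\<in>grid_idx M. ?D k u i * ?D k (\<lambda>i. u i - w i) i)"
    by (simp add: sum_subtractf)
  have "h ^ CARD('d) / h\<^sup>2 \<ge> 0" using h by simp
  moreover have "c * (A - B) \<le> c * (2 * C) \<Longrightarrow> 2 * (- c * C) \<le> - c * A - - c * B" for A B C c :: real
    by (simp add: algebra_simps)
  ultimately show ?thesis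
    using mult_left_mono[OF *]
    unfolding grid_inner_laplacian[OF M u u] grid_inner_laplacian[OF M w w]
      grid_inner_laplacian[OF M u d]
    by blast
qed

section \<open>Pointwise bounds for the double-well potential\<close>

text \<open>The Taylor remainder of the quartic is exactly a quadratic in \<open>a\<close> and
  \<open>b\<close> times \<open>(b - a)\<^sup>2\<close>; on \<open>[-1,1]\<close> that quadratic is
  at most 1.\<close>

lemma pot_F_quadratic_bound:
  assumes a: "\<bar>a\<bar> \<le> 1" and b: "\<bar>b\<bar> \<le> 1" and S: "S \<ge> 2"
  shows "pot_F b - pot_F a \<le> - pot_f a * (b - a) + S * (b - a)\<^sup>2"
proof -
  have sq: "a\<^sup>2 \<le> 1" "b\<^sup>2 \<le> 1" using a b by (simp_all add: abs_square_le_1)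
  have "2 * (a * b) \<le> a\<^sup>2 + b\<^sup>2" using sum_squares_bound[of a b] by (simp add: mult.assoc)
  with sq S have "(b\<^sup>2 + 2 * (a * b) + 3 * a\<^sup>2) / 4 - 1 / 2 \<le> S" by argo
  then have "((b\<^sup>2 + 2 * (a * b) + 3 * a\<^sup>2) / 4 - 1 / 2) * (b - a)\<^sup>2 \<le> S * (b - a)\<^sup>2"
    by (intro mult_right_mono) simp_all
  moreover have "pot_F b - pot_F a + pot_f a * (b - a)
      = ((b\<^sup>2 + 2 * (a * b) + 3 * a\<^sup>2) / 4 - 1 / 2) * (b - a)\<^sup>2"
    by (simp add: pot_F_def pot_f_def field_simps power2_eq_square power3_eq_cube)
  ultimately show ?thesis by linarith
qed

text \<open>Factor \<open>pot_f a\<close> as \<open>a * (1 + a) * (1 - a)\<close>, where the first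
  two factors have product at most 2.\<close>

lemma pot_f_le:
  assumes "\<bar>a\<bar> \<le> 1" "S \<ge> 2"
  shows "pot_f a \<le> S * (1 - a)"
proof -
  have "a * (1 + a) \<le> 2"
    using assms(1) abs_square_le_1[of a] by (simp add: algebra_simps power2_eq_square)
  with assms(2) have "a * (1 + a) \<le> S" by linarith
  then have "a * (1 + a) * (1 - a) \<le> S * (1 - a)"
    using assms(1) by (intro mult_right_mono) auto
  then show ?thesis by (simp add: pot_f_def algebra_simps power3_eq_cube)
qed

section \<open>The discrete maximum principle\<close>

text \<open>The maximum is taken over all integer indices, since neighbours of a cell point may lie
  outside the cell.\<close>

lemma grid_space_maximum:
  assumes "M > 0" "v \<in> grid_space M"
  obtains i where "\<And>j. v j \<le> v i"
proof -
  let ?V = "v ` grid_idx M"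
  have fin: "finite ?V" "?V \<noteq> {}"
    using assms(1) by (simp_all add: finite_grid_idx grid_idx_nonempty)
  then obtain i where "v i = Max ?V" by (metis (no_types, lifting) Max_in imageE)
  moreover have "v j \<le> Max ?V" for j
    using Max_ge[OF fin(1) imageI[OF grid_wrap_in[OF assms(1), of j]]]
    by (simp add: grid_space_wrap[OF assms(2)])
  ultimately show thesis by (intro that[of i]) simp
qed

text \<open>Here \<open>r\<close> stands for the time step times the mobility. At a maximum of
  \<open>v\<close> the step gives \<open>(1 + r i * S) * (v i - 1) \<le> u i - 1\<close>, whose
  factor is at least 1 however large or small \<open>r i\<close> is: no step restriction arises, and
  \<open>r i = 0\<close> is covered.\<close>

lemma stabilized_step_le_1:
  fixes u v :: "('d::finite) gridfun"
  assumes M: "M > 0" and v: "v \<in> grid_space M" and u: "\<And>i. \<bar>u i\<bar> \<le> 1"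
    and S: "S \<ge> 2" and r: "\<And>i. r i \<ge> 0"
    and eq: "\<And>i. v i - u i
      = - r i * (- \<epsilon>\<^sup>2 * grid_laplacian h v i - pot_f (u i) + S * (v i - u i))"
  shows "v j \<le> 1"
proof -
  obtain i where max: "\<And>j. v j \<le> v i" using grid_space_maximum[OF M v] by blast
  have "(\<Sum>k\<in>UNIV. v (i + axis k 1) - 2 * v i + v (i - axis k 1)) \<le> 0"
  proof (intro sum_nonpos)
    fix k
    show "v (i + axis k 1) - 2 * v i + v (i - axis k 1) \<le> 0"
      using max[of "i + axis k 1"] max[of "i - axis k 1"] by simp
  qed
  then have "grid_laplacian h v i \<le> 0"
    by (simp add: grid_laplacian_def divide_nonpos_nonneg)
  then have "\<epsilon>\<^sup>2 * grid_laplacian h v i \<le> 0" by (simp add: mult_nonneg_nonpos)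
  \<comment> \<open>The bound \<open>pot_f (u i) \<le> S * (1 - u i)\<close> cancels the
    \<open>u i\<close> in the stabilisation term.\<close>
  then have "- \<epsilon>\<^sup>2 * grid_laplacian h v i - pot_f (u i) + S * (v i - u i) \<ge> S * (v i - 1)"
    using pot_f_le[OF u S, of i] by (simp add: algebra_simps)
  from mult_left_mono[OF this r[of i]] have "v i - u i \<le> - r i * (S * (v i - 1))"
    using eq[of i] by simp
  then have "(1 + r i * S) * (v i - 1) \<le> u i - 1" by (simp add: algebra_simps)
  also have "\<dots> \<le> 0" using u[of i] by simp
  finally have "v i - 1 \<le> 0"
    using r[of i] S by (smt (verit) mult_nonneg_nonneg mult_le_0_iff)
  with max[of j] show ?thesis by simp
qed

text \<open>Since \<open>pot_f\<close> is odd and the Laplacian linear, \<open>-u\<close> and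
  \<open>-v\<close> satisfy the same step. The coefficient \<open>r\<close> stays fixed under this
  reflection, even when the mobility is not an even function.\<close>

lemma stabilized_step_bound:
  fixes u v :: "('d::finite) gridfun"
  assumes M: "M > 0" and v: "v \<in> grid_space M" and u: "\<And>i. \<bar>u i\<bar> \<le> 1"
    and S: "S \<ge> 2" and r: "\<And>i. r i \<ge> 0"
    and eq: "\<And>i. v i - u i
      = - r i * (- \<epsilon>\<^sup>2 * grid_laplacian h v i - pot_f (u i) + S * (v i - u i))"
  shows "\<bar>v j\<bar> \<le> 1"
proof -
  have "v j \<le> 1" by (rule stabilized_step_le_1[OF M v u S r eq])
  moreover have "- v j \<le> 1"
  proof (rule stabilized_step_le_1[OF M _ _ S r])
    show "(\<lambda>i. - v i) \<in> grid_space M" using v by (simp add: grid_space_def)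
    show "\<bar>- u i\<bar> \<le> 1" for i using u by simp
    have "grid_laplacian h (\<lambda>i. - v i) i = - grid_laplacian h v i" for i
    proof -
      have "(\<Sum>k\<in>UNIV. - v (i + axis k 1) - 2 * - v i + - v (i - axis k 1))
          = (\<Sum>k\<in>UNIV. - (v (i + axis k 1) - 2 * v i + v (i - axis k 1)))"
        by (intro sum.cong) auto
      then show ?thesis by (simp only: grid_laplacian_def sum_negf mult_minus_right)
    qed
    then show "- v i - - u i = - r i * (- \<epsilon>\<^sup>2 * grid_laplacian h (\<lambda>i. - v i) i
        - pot_f (- u i) + S * (- v i - - u i))" for i
      using eq[of i] by (simp add: pot_f_def algebra_simps)
  qed
  ultimately show ?thesis by simp
qed

section \<open>Energy estimate for one step, then induction in time\<close>

lemma stabilized_step_energy: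
  fixes u v m :: "('d::finite) gridfun"
  assumes M: "M > 0" and h: "h > 0" and uper: "u \<in> grid_space M" and vper: "v \<in> grid_space M"
    and u: "\<And>i. \<bar>u i\<bar> \<le> 1" and v: "\<And>i. \<bar>v i\<bar> \<le> 1" and S: "S \<ge> 2"
    and m: "\<And>i. m i = - \<epsilon>\<^sup>2 * grid_laplacian h v i - pot_f (u i) + S * (v i - u i)"
  shows "grid_energy \<epsilon> h M v - grid_energy \<epsilon> h M u \<le> grid_inner h M m (\<lambda>i. v i - u i)"
proof -
  let ?w = "\<lambda>i. v i - u i"
  let ?L = "grid_inner h M (grid_laplacian h v) ?w"
  have hd: "h ^ CARD('d) \<ge> 0" using h by simp
  have "(\<Sum>i\<in>grid_idx M. pot_F (v i) - pot_F (u i))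
      \<le> (\<Sum>i\<in>grid_idx M. (m i + \<epsilon>\<^sup>2 * grid_laplacian h v i) * ?w i)"
  proof (rule sum_mono)
    fix i
    \<comment> \<open>By the definition of \<open>m\<close>, \<open>m i\<close> plus the Laplacian
      term equals \<open>- pot_f (u i) + S * ?w i\<close>, so this is the quadratic bound.\<close>
    show "pot_F (v i) - pot_F (u i) \<le> (m i + \<epsilon>\<^sup>2 * grid_laplacian h v i) * ?w i"
      using pot_F_quadratic_bound[OF u v S, of i i]
      by (simp add: m power2_eq_square algebra_simps)
  qed
  also have "\<dots> = (\<Sum>i\<in>grid_idx M. m i * ?w i) + \<epsilon>\<^sup>2 * (\<Sum>i\<in>grid_idx M. grid_laplacian h v i * ?w i)"
    by (simp only: distrib_right sum.distrib sum_distrib_left mult.assoc)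
  finally have "grid_inner h M (\<lambda>i. pot_F (v i)) (\<lambda>i. 1) - grid_inner h M (\<lambda>i. pot_F (u i)) (\<lambda>i. 1)
      \<le> grid_inner h M m ?w + \<epsilon>\<^sup>2 * ?L"
    using mult_left_mono[OF _ hd] unfolding grid_inner_def
    by (fastforce simp: sum_subtractf right_diff_distrib distrib_left mult.left_commute)
  \<comment> \<open>Convexity supplies exactly the \<open>\<epsilon>\<^sup>2 * ?L\<close> that
    cancels the surplus in the potential estimate.\<close>
  moreover have "\<epsilon>\<^sup>2 / 2 * (2 * ?L) \<le> \<epsilon>\<^sup>2 / 2 *
      (grid_inner h M (grid_laplacian h v) v - grid_inner h M (grid_laplacian h u) u)"
    by (intro mult_left_mono gradient_energy_convex[OF M h vper uper]) simp
  ultimately show ?thesis by (simp add: grid_energy_def right_diff_distrib)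
qed

theorem theorem2p5:
  fixes L h \<epsilon> S1 T :: real
    and M N :: nat
    and t \<tau> :: "nat \<Rightarrow> real"
    and mob :: "real \<Rightarrow> real"
    and \<phi>init :: "real ^ 'd::finite \<Rightarrow> real"
    and \<phi> \<mu> :: "nat \<Rightarrow> 'd gridfun"
  assumes dim: "CARD('d) \<in> {1, 2, 3}"
    and eps: "\<epsilon> > 0"
    and mobility: "\<And>s. s \<in> {-1..1} \<Longrightarrow> mob s \<ge> 0"
    and space_grid: "L > 0" "M > 0" "h = L / real M"
    and time_grid: "t 0 = 0" "\<And>k. k < N \<Longrightarrow> t k < t (k + 1)" "t N = T"
    and step: "\<And>k. k \<in> {1..N} \<Longrightarrow> \<tau> k = t k - t (k - 1)"
    and S1: "S1 \<ge> (SUP s\<in>{-1..1}. \<bar>deriv pot_f s\<bar>)"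
    and init: "grid_norm_inf M (\<lambda>i. \<phi>init (grid_point h i)) \<le> 1"
    and solution: "DsBE_solution \<epsilon> mob S1 h M N \<tau> \<phi>init \<phi> \<mu>"
  shows "\<forall>n<N. grid_energy \<epsilon> h M (\<phi> (n + 1)) - grid_energy \<epsilon> h M (\<phi> n)
           \<le> - \<tau> (n + 1) * grid_inner h M (\<lambda>i. mob (\<phi> n i) * \<mu> (n + 1) i) (\<mu> (n + 1))"
proof (intro allI impI)
  fix n assume n: "n < N"
  have h: "h > 0" using space_grid by simp
  have S: "S1 \<ge> 2" using S1 by (simp add: SUP_deriv_pot_f)
  have tau: "\<tau> (k + 1) > 0" if "k < N" for k
    using step[of "k + 1"] time_grid(2)[OF that] that by simp
  have per: "\<phi> k \<in> grid_space M" if "k \<le> N" for k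
    using solution that by (simp add: DsBE_solution_def)
  have mu: "\<mu> (k + 1) i = - \<epsilon>\<^sup>2 * grid_laplacian h (\<phi> (k + 1)) i - pot_f (\<phi> k i)
      + S1 * (\<phi> (k + 1) i - \<phi> k i)" if "k < N" for k i
    using solution that by (simp add: DsBE_solution_def)
  have diff: "\<phi> (k + 1) i - \<phi> k i = - (\<tau> (k + 1) * mob (\<phi> k i)) * \<mu> (k + 1) i" if "k < N" for k i
  proof -
    have "(\<phi> (k + 1) i - \<phi> k i) / \<tau> (k + 1) = - mob (\<phi> k i) * \<mu> (k + 1) i"
      using solution that unfolding DsBE_solution_def by blast
    with tau[OF that] show ?thesis by (simp add: field_simps)
  qed
  have bound: "\<bar>\<phi> k i\<bar> \<le> 1" if "k \<le> N" for k i
    using that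
  proof (induction k arbitrary: i)
    case 0
    \<comment> \<open>The initial datum is controlled only on the cell, whereas the induction runs
      over all integer indices.\<close>
    let ?j = "grid_wrap M i"
    have j: "?j \<in> grid_idx M" using space_grid(2) by (rule grid_wrap_in)
    have "\<bar>\<phi>init (grid_point h ?j)\<bar> \<le> grid_norm_inf M (\<lambda>i. \<phi>init (grid_point h i))"
      unfolding grid_norm_inf_def using j by (intro Max_ge) (auto simp: finite_grid_idx)
    moreover have "\<phi> 0 i = \<phi>init (grid_point h ?j)"
      using solution j grid_space_wrap[OF per[of 0], of i] by (simp add: DsBE_solution_def)
    ultimately show ?case using init by simp
  next
    case (Suc k)
    then have k: "k < N" and IH: "\<And>i. \<bar>\<phi> k i\<bar> \<le> 1" by simp_all
    \<comment> \<open>The mobility is known to be nonnegative only on \<open>[-1,1]\<close>, so the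
      induction hypothesis is what gives the sign.\<close>
    have "\<tau> (k + 1) * mob (\<phi> k i) \<ge> 0" for i
      using tau[OF k] mobility[of "\<phi> k i"] IH[of i] by (simp add: abs_le_iff)
    moreover have "\<phi> (k + 1) \<in> grid_space M" using k by (intro per) simp
    ultimately have "\<bar>\<phi> (k + 1) i\<bar> \<le> 1"
      using stabilized_step_bound[OF space_grid(2) _ IH S _ diff[OF k, unfolded mu[OF k]]] by blast
    then show ?case by simp
  qed
  have "grid_energy \<epsilon> h M (\<phi> (n + 1)) - grid_energy \<epsilon> h M (\<phi> n)
      \<le> grid_inner h M (\<mu> (n + 1)) (\<lambda>i. \<phi> (n + 1) i - \<phi> n i)"
    using n by (intro stabilized_step_energy[OF space_grid(2) h _ _ _ _ S mu] per bound) simp_all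
  \<comment> \<open>An equality: the increment is \<open>- \<tau> (n + 1)\<close> times mobility
    times chemical potential at each index.\<close>
  also have "\<dots> = - \<tau> (n + 1) * grid_inner h M (\<lambda>i. mob (\<phi> n i) * \<mu> (n + 1) i) (\<mu> (n + 1))"
    unfolding grid_inner_def
    by (simp only: diff[OF n] sum_distrib_left mult_ac minus_mult_left[symmetric] minus_mult_right[symmetric])
  finally show "grid_energy \<epsilon> h M (\<phi> (n + 1)) - grid_energy \<epsilon> h M (\<phi> n)
      \<le> - \<tau> (n + 1) * grid_inner h M (\<lambda>i. mob (\<phi> n i) * \<mu> (n + 1) i) (\<mu> (n + 1))" .
qed

end
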